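(* Let $G$ be a group acting properly and by isometries on a metric space $M$. For any $G$-invariant subsets $X, Y \subseteq M$, we have $$d_{\mathrm{H}}(X/G, Y/G) = d_{\mathrm{H}}(X, Y),$$ where $d_{\mathrm{H}}(X,Y)$ is the Hausdorff distance in $M$ and $d_{\mathrm{H}}(X/G,Y/G)$ is the Hausdorff distance in the quotient metric space $M/G$.
   Context: An action of a group $G$ on a metric space $(M,d)$ is isometric (by isometries) if for every $g\in G$ the map $x\mapsto g\cdot x$ preserves distances. It is proper if for each $x\in M$ there is some $r>0$ such that the set $\{g\in G : (g\cdot B(x,r))\cap B(x,r)\neq\emptyset\}$ is finite, where $B(x,r)$ is the ball of radius $r$ about $x$. A subset $X\subseteq M$ is $G$-invariant if $X=G\cdot X:=\{g\cdot x : g\in G,\ x\in X\}$. For a proper isometric action, the orbit space $M/G$ carries the quotient metric $d_{M/G}([x],[x'])=\inf_{g\in G} d(x,g\cdot x')$, where $[x]$ denotes the orbit of $x$; for $G$-invariant $X\subseteq M$, $X/G$ is the subset of $M/G$ consisting of the orbits of points of $X$. For subsets $X,Y$ of a metric space $(Z,d)$, the $\varepsilon$-thickening of $X$ is $X^\varepsilon=\{z\in Z : d(z,x)<\varepsilon \text{ for some } x\in X\}$, and the Hausdorff distance is $d_{\mathrm{H}}(X,Y)=\inf\{\varepsilon>0 : X\subseteq Y^\varepsilon \text{ and } Y\subseteq X^\varepsilon\}$. *)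

theory Defs
  imports "HOL-Analysis.Analysis" "HOL-Algebra.Group_Action"
begin

definition isometric_action ::
  "('g, 'r) monoid_scheme \<Rightarrow> 'a set \<Rightarrow> ('a \<Rightarrow> 'a \<Rightarrow> real) \<Rightarrow> ('g \<Rightarrow> 'a \<Rightarrow> 'a) \<Rightarrow> bool" where
  "isometric_action G M d \<phi> \<longleftrightarrow>
     (\<forall>g\<in>carrier G. \<forall>x\<in>M. \<forall>y\<in>M. d (\<phi> g x) (\<phi> g y) = d x y)"

definition proper_action ::
  "('g, 'r) monoid_scheme \<Rightarrow> 'a set \<Rightarrow> ('a \<Rightarrow> 'a \<Rightarrow> real) \<Rightarrow> ('g \<Rightarrow> 'a \<Rightarrow> 'a) \<Rightarrow> bool" where
  "proper_action G M d \<phi> \<longleftrightarrow>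
     (\<forall>x\<in>M. \<exists>r>0. finite {g \<in> carrier G.
        \<phi> g ` Metric_space.mball M d x r \<inter> Metric_space.mball M d x r \<noteq> {}})"

definition invariant_set ::
  "('g, 'r) monoid_scheme \<Rightarrow> ('g \<Rightarrow> 'a \<Rightarrow> 'a) \<Rightarrow> 'a set \<Rightarrow> bool" where
  "invariant_set G \<phi> X \<longleftrightarrow> X = {\<phi> g x | g x. g \<in> carrier G \<and> x \<in> X}"

text \<open>
  Points of the orbit space are orbits, as elements of \<open>orbits G M \<phi>\<close>; the distance is computed
  from arbitrarily chosen representatives, and \<open>quotient_dist_orbit\<close> below shows that the choice
  does not matter.  The value outside the orbit space is irrelevant; 0 makes the function
  nonnegative and symmetric everywhere, as \<open>Metric_space\<close> demands.
\<close>
definition quotient_dist ::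
  "('g, 'r) monoid_scheme \<Rightarrow> 'a set \<Rightarrow> ('a \<Rightarrow> 'a \<Rightarrow> real) \<Rightarrow> ('g \<Rightarrow> 'a \<Rightarrow> 'a)
     \<Rightarrow> 'a set \<Rightarrow> 'a set \<Rightarrow> real" where
  "quotient_dist G M d \<phi> A B =
     (if A \<in> orbits G M \<phi> \<and> B \<in> orbits G M \<phi>
      then INF g\<in>carrier G. d (SOME x. x \<in> A) (\<phi> g (SOME y. y \<in> B))
      else 0)"

definition thickening :: "'z set \<Rightarrow> ('z \<Rightarrow> 'z \<Rightarrow> real) \<Rightarrow> real \<Rightarrow> 'z set \<Rightarrow> 'z set" where
  "thickening Z d \<epsilon> X = {z \<in> Z. \<exists>x\<in>X. d z x < \<epsilon>}"

text \<open>
  Values are in \<open>[0, \<infinity>]\<close>: the infimum of the empty set is \<open>\<infinity>\<close>, e.g. when exactly one of the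
  sets is empty.
\<close>
definition hausdorff_dist :: "'z set \<Rightarrow> ('z \<Rightarrow> 'z \<Rightarrow> real) \<Rightarrow> 'z set \<Rightarrow> 'z set \<Rightarrow> ennreal" where
  "hausdorff_dist Z d X Y =
     Inf {ennreal \<epsilon> | \<epsilon>. \<epsilon> > 0 \<and> X \<subseteq> thickening Z d \<epsilon> Y \<and> Y \<subseteq> thickening Z d \<epsilon> X}"

lemma quotient_dist_orbit:
  fixes G (structure)
  assumes M: "Metric_space M d" and A: "group_action G M \<phi>" and I: "isometric_action G M d \<phi>"
    and x: "x \<in> M" and y: "y \<in> M"
  shows "quotient_dist G M d \<phi> (orbit G \<phi> x) (orbit G \<phi> y) = (INF g\<in>carrier G. d x (\<phi> g y))"
proof -
  interpret Metric_space M d by fact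
  interpret group_action G M \<phi> by fact
  interpret G: group G using group_hom by (rule group_hom.axioms(1))
  define x' y' where "x' = (SOME u. u \<in> orbit G \<phi> x)" and "y' = (SOME u. u \<in> orbit G \<phi> y)"
  have "x' \<in> orbit G \<phi> x" "y' \<in> orbit G \<phi> y"
    unfolding x'_def y'_def using orbit_refl x y by (metis someI)+
  then obtain a b where a: "a \<in> carrier G" "x' = \<phi> a x" and b: "b \<in> carrier G" "y' = \<phi> b y"
    by (auto simp: orbit_def)
  have inv_act: "\<phi> c (\<phi> (inv c) z) = z" if "c \<in> carrier G" "z \<in> M" for c z
    using that orbit_sym_aux[of "inv c" z] by simp
  have eq: "d x' (\<phi> g y') = d x (\<phi> (inv a \<otimes> g \<otimes> b) y)" if g: "g \<in> carrier G" for g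
  proof -
    have gM: "\<phi> (inv a \<otimes> (g \<otimes> b)) y \<in> M"
      using a b g y by (intro element_image[OF _ y refl]) auto
    have "\<phi> a (\<phi> (inv a \<otimes> (g \<otimes> b)) y) = \<phi> g y'"
      using a b g y inv_act[of a "\<phi> (g \<otimes> b) y"] element_image[OF _ y refl, of "g \<otimes> b"]
      by (simp add: composition_rule)
    then have "d x' (\<phi> g y') = d (\<phi> a x) (\<phi> a (\<phi> (inv a \<otimes> (g \<otimes> b)) y))"
      using a by simp
    also have "\<dots> = d x (\<phi> (inv a \<otimes> (g \<otimes> b)) y)"
      using I a x gM by (simp add: isometric_action_def)
    finally show ?thesis using a b g by (simp add: G.m_assoc)
  qed
  have im: "(\<lambda>g. inv a \<otimes> g \<otimes> b) ` carrier G = carrier G"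
  proof
    show "carrier G \<subseteq> (\<lambda>g. inv a \<otimes> g \<otimes> b) ` carrier G"
    proof
      fix h assume h: "h \<in> carrier G"
      have "h = inv a \<otimes> (a \<otimes> h \<otimes> inv b) \<otimes> b"
        using a b h by (simp add: G.m_assoc) (simp add: G.m_assoc[symmetric])
      then show "h \<in> (\<lambda>g. inv a \<otimes> g \<otimes> b) ` carrier G" using a b h by blast
    qed
  qed (use a b in auto)
  have "(\<lambda>g. d x' (\<phi> g y')) ` carrier G
      = (\<lambda>h. d x (\<phi> h y)) ` ((\<lambda>g. inv a \<otimes> g \<otimes> b) ` carrier G)"
    unfolding image_image using eq by (intro image_cong) auto
  then have "(INF g\<in>carrier G. d x' (\<phi> g y')) = (INF g\<in>carrier G. d x (\<phi> g y))"
    by (simp only: im)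
  moreover have "orbit G \<phi> x \<in> orbits G M \<phi>" "orbit G \<phi> y \<in> orbits G M \<phi>"
    using x y by (auto simp: orbits_def)
  ultimately show ?thesis by (simp add: quotient_dist_def x'_def y'_def)
qed

lemma quotient_dist_less_iff:
  assumes "Metric_space M d" "group_action G M \<phi>" "isometric_action G M d \<phi>" "x \<in> M" "y \<in> M"
  shows "quotient_dist G M d \<phi> (orbit G \<phi> x) (orbit G \<phi> y) < e
           \<longleftrightarrow> (\<exists>g\<in>carrier G. d x (\<phi> g y) < e)"
proof -
  interpret Metric_space M d by fact
  interpret group_action G M \<phi> by fact
  interpret G: group G using group_hom by (rule group_hom.axioms(1))
  have "carrier G \<noteq> {}" using G.one_closed by blast
  moreover have "bdd_below ((\<lambda>g. d x (\<phi> g y)) ` carrier G)" by (rule bdd_belowI[of _ 0]) auto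
  ultimately show ?thesis
    unfolding quotient_dist_orbit[OF assms] by (rule cINF_less_iff)
qed

lemma Metric_space_quotient:
  fixes G (structure)
  assumes M: "Metric_space M d" and A: "group_action G M \<phi>" and I: "isometric_action G M d \<phi>"
    and P: "proper_action G M d \<phi>"
  shows "Metric_space (orbits G M \<phi>) (quotient_dist G M d \<phi>)"
proof -
  interpret Metric_space M d by fact
  interpret group_action G M \<phi> by fact
  interpret G: group G using group_hom by (rule group_hom.axioms(1))
  let ?q = "quotient_dist G M d \<phi>"
  note less = quotient_dist_less_iff[OF M A I]
  have iso: "d (\<phi> g u) (\<phi> g v) = d u v" if "g \<in> carrier G" "u \<in> M" "v \<in> M" for g u v
    using I that by (auto simp: isometric_action_def)
  have cl: "\<phi> g u \<in> M" if "g \<in> carrier G" "u \<in> M" for g u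
    using that element_image by blast
  have inv_act: "\<phi> (inv c) (\<phi> c z) = z" if "c \<in> carrier G" "z \<in> M" for c z
    using that orbit_sym_aux[of c z] by simp
  have nn: "0 \<le> ?q (orbit G \<phi> x) (orbit G \<phi> y)" if "x \<in> M" "y \<in> M" for x y
    using less[OF that, of 0] by (meson linorder_not_less nonneg)
  have le: "?q (orbit G \<phi> y) (orbit G \<phi> x) \<le> ?q (orbit G \<phi> x) (orbit G \<phi> y)"
    if xy: "x \<in> M" "y \<in> M" for x y
  proof (rule dense_ge)
    fix e assume "?q (orbit G \<phi> x) (orbit G \<phi> y) < e"
    then obtain g where g: "g \<in> carrier G" "d x (\<phi> g y) < e"
      unfolding less[OF xy] by blast
    have "d y (\<phi> (inv g) x) = d x (\<phi> g y)"
      using iso[of "inv g" x "\<phi> g y"] g xy cl[of g y] inv_act[of g y] by (simp add: commute)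
    then have "?q (orbit G \<phi> y) (orbit G \<phi> x) < e"
      unfolding less[OF xy(2,1)] using g by (intro bexI[of _ "inv g"]) auto
    then show "?q (orbit G \<phi> y) (orbit G \<phi> x) \<le> e" by simp
  qed
  have sep: "orbit G \<phi> x = orbit G \<phi> y"
    if xy: "x \<in> M" "y \<in> M" and z: "?q (orbit G \<phi> x) (orbit G \<phi> y) = 0" for x y
  proof -
    obtain r where r: "r > 0" and fin: "finite {g \<in> carrier G. \<phi> g ` mball x r \<inter> mball x r \<noteq> {}}"
      using P xy by (auto simp: proper_action_def)
    define H where "H = {g \<in> carrier G. \<phi> g ` mball x r \<inter> mball x r \<noteq> {}}"
    obtain g where g: "g \<in> carrier G" "d x (\<phi> g y) < r" using less[OF xy, of r] r z by auto
    let ?y = "\<phi> g y"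
    have yM: "?y \<in> M" using cl g xy by simp
    have H1: "k \<otimes> inv g \<in> H \<and> \<phi> (k \<otimes> inv g) ?y = \<phi> k y"
      if k: "k \<in> carrier G" "d x (\<phi> k y) < r" for k
    proof -
      have "\<phi> (k \<otimes> inv g) ?y = \<phi> k y"
        using g k xy yM inv_act by (simp add: composition_rule)
      moreover have "?y \<in> mball x r" "\<phi> k y \<in> mball x r" using g k xy yM cl by auto
      ultimately show ?thesis using g k unfolding H_def by (auto intro!: exI[of _ "\<phi> k y"] image_eqI[of _ _ ?y])
    qed
    have "\<exists>h\<in>H. \<phi> h ?y = x"
    proof (rule ccontr)
      assume no: "\<not> ?thesis"
      define e where "e = Min (insert r ((\<lambda>h. d x (\<phi> h ?y)) ` H))"
      have fH: "finite H" using fin H_def by simp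
      have "e > 0"
        unfolding e_def using fH r no xy yM cl by (subst Min_gr_iff) (auto simp: H_def)
      then obtain k where k: "k \<in> carrier G" "d x (\<phi> k y) < e" using less[OF xy, of e] z by auto
      have "e \<le> r" unfolding e_def using fH by (intro Min_le) auto
      then have "k \<otimes> inv g \<in> H" "\<phi> (k \<otimes> inv g) ?y = \<phi> k y" using H1[of k] k by auto
      then have "e \<le> d x (\<phi> k y)" unfolding e_def using fH by (intro Min_le) force+
      then show False using k by simp
    qed
    then obtain h where h: "h \<in> carrier G" "\<phi> h ?y = x" by (auto simp: H_def)
    then have "x \<in> orbit G \<phi> y"
      using g xy composition_rule[of y h g]
      by (auto simp: orbit_def intro!: exI[of _ "h \<otimes> g"])
    moreover have "orbit G \<phi> u \<subseteq> M" if "u \<in> M" for u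
      using that cl by (auto simp: orbit_def)
    ultimately show ?thesis
      using xy orbit_sym[of y x] orbit_trans[of x y] orbit_trans[of y x] by blast
  qed
  show ?thesis
  proof
    fix A B
    show "0 \<le> ?q A B"
    proof (cases "A \<in> orbits G M \<phi> \<and> B \<in> orbits G M \<phi>")
      case True
      then show ?thesis using nn by (auto simp: orbits_def)
    next
      case False
      then show ?thesis unfolding quotient_dist_def by (simp only: if_False)
    qed
    show "?q A B = ?q B A"
    proof (cases "A \<in> orbits G M \<phi> \<and> B \<in> orbits G M \<phi>")
      case True
      then obtain x y where "x \<in> M" "y \<in> M" "A = orbit G \<phi> x" "B = orbit G \<phi> y"
        by (auto simp: orbits_def)
      then show ?thesis using le by (simp add: order_antisym)
    next
      case False
      then show ?thesis unfolding quotient_dist_def by (simp only: if_False conj_commute[of "B \<in> _"])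
    qed
  next
    fix A B assume "A \<in> orbits G M \<phi>" "B \<in> orbits G M \<phi>"
    then obtain x y where xy: "x \<in> M" "y \<in> M" "A = orbit G \<phi> x" "B = orbit G \<phi> y"
      by (auto simp: orbits_def)
    have "?q (orbit G \<phi> x) (orbit G \<phi> x) \<le> 0"
    proof (rule dense_ge)
      fix e :: real assume "0 < e"
      moreover have "\<phi> \<one> x = x" using inv_act[of \<one> x] xy composition_rule[of x \<one> \<one>] by simp
      ultimately have "?q (orbit G \<phi> x) (orbit G \<phi> x) < e"
        unfolding less[OF xy(1) xy(1)] using xy by (intro bexI[of _ \<one>]) auto
      then show "?q (orbit G \<phi> x) (orbit G \<phi> x) \<le> e" by simp
    qed
    then show "?q A B = 0 \<longleftrightarrow> A = B" using sep xy nn by (metis order_antisym)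
  next
    fix A B C assume "A \<in> orbits G M \<phi>" "B \<in> orbits G M \<phi>" "C \<in> orbits G M \<phi>"
    then obtain x y z where xyz: "x \<in> M" "y \<in> M" "z \<in> M"
      and ABC: "A = orbit G \<phi> x" "B = orbit G \<phi> y" "C = orbit G \<phi> z"
      by (auto simp: orbits_def)
    show "?q A C \<le> ?q A B + ?q B C"
    proof (rule field_le_epsilon)
      fix e :: real assume e: "0 < e"
      obtain g where g: "g \<in> carrier G" "d x (\<phi> g y) < ?q A B + e / 2"
        using less[of x y "?q A B + e / 2"] xyz ABC e by auto
      obtain h where h: "h \<in> carrier G" "d y (\<phi> h z) < ?q B C + e / 2"
        using less[of y z "?q B C + e / 2"] xyz ABC e by auto
      have "d x (\<phi> (g \<otimes> h) z) \<le> d x (\<phi> g y) + d (\<phi> g y) (\<phi> g (\<phi> h z))"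
        using triangle[of x "\<phi> g y" "\<phi> (g \<otimes> h) z"] g h xyz cl by (simp add: composition_rule)
      also have "\<dots> < ?q A B + ?q B C + e" using g h iso xyz cl by simp
      finally have "?q A C < ?q A B + ?q B C + e"
        unfolding ABC less[OF xyz(1,3)] using g h by (intro bexI[of _ "g \<otimes> h"]) auto
      then show "?q A C \<le> ?q A B + ?q B C + e" by simp
    qed
  qed
qed

end

theory Submission
  imports Defs
begin

text \<open>For each fixed \<open>\<epsilon>\<close>, an inclusion into an
  \<open>\<epsilon>\<close>-thickening holds in M exactly when it holds in M/G, so both Hausdorff
  distances are infima of the same set. Indeed [x] is closer than \<open>\<epsilon>\<close> to [y]
  iff x is closer than \<open>\<epsilon>\<close> to some translate of y, and invariance puts that
  translate back in Y. The equivalence is \<open>orbits_subset_thickening_iff\<close>.\<close>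

lemma orbits_subset_thickening_iff:
  assumes act: "Metric_space M d" "group_action G M \<phi>" "isometric_action G M d \<phi>"
    and X: "X \<subseteq> M" and Y: "Y \<subseteq> M" "invariant_set G \<phi> Y"
  shows "orbits G X \<phi> \<subseteq> thickening (orbits G M \<phi>) (quotient_dist G M d \<phi>) \<epsilon> (orbits G Y \<phi>)
           \<longleftrightarrow> X \<subseteq> thickening M d \<epsilon> Y"
proof -
  have pointwise: "(\<exists>y\<in>Y. quotient_dist G M d \<phi> (orbit G \<phi> x) (orbit G \<phi> y) < \<epsilon>)
      \<longleftrightarrow> (\<exists>y\<in>Y. d x y < \<epsilon>)" if x: "x \<in> X" for x
  proof -
    \<comment> \<open>Strictness matters: an infimum lies below \<open>\<epsilon>\<close> iff one of
      its members does, so it need not be attained.\<close>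
    have "(\<exists>y\<in>Y. quotient_dist G M d \<phi> (orbit G \<phi> x) (orbit G \<phi> y) < \<epsilon>)
        \<longleftrightarrow> (\<exists>y\<in>Y. \<exists>g\<in>carrier G. d x (\<phi> g y) < \<epsilon>)"
      using quotient_dist_less_iff[OF act] x X Y(1) by (meson subsetD)
    also have "\<dots> \<longleftrightarrow> (\<exists>z\<in>{\<phi> g y | g y. g \<in> carrier G \<and> y \<in> Y}. d x z < \<epsilon>)"
      by blast
    \<comment> \<open>By invariance, the set of all translates of points of Y is Y itself.\<close>
    also have "\<dots> \<longleftrightarrow> (\<exists>y\<in>Y. d x y < \<epsilon>)"
      using Y(2) unfolding invariant_set_def by (rule arg_cong[where f = "\<lambda>S. \<exists>z\<in>S. d x z < \<epsilon>", OF sym])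
    finally show ?thesis .
  qed
  \<comment> \<open>Elements of \<open>orbits G X \<phi>\<close> are orbits of points of X, and X
    lying in M makes them points of the orbit space.\<close>
  have "orbits G X \<phi> \<subseteq> thickening (orbits G M \<phi>) (quotient_dist G M d \<phi>) \<epsilon> (orbits G Y \<phi>)
      \<longleftrightarrow> (\<forall>x\<in>X. \<exists>y\<in>Y. quotient_dist G M d \<phi> (orbit G \<phi> x) (orbit G \<phi> y) < \<epsilon>)"
    using X unfolding orbits_def thickening_def by blast
  also have "\<dots> \<longleftrightarrow> X \<subseteq> thickening M d \<epsilon> Y"
    using X pointwise unfolding thickening_def by blast
  finally show ?thesis .
qed

theorem theorem4p2:
  fixes G :: "('g, 'r) monoid_scheme" and M :: "'a set" and d :: "'a \<Rightarrow> 'a \<Rightarrow> real"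
    and \<phi> :: "'g \<Rightarrow> 'a \<Rightarrow> 'a" and X Y :: "'a set"
  assumes "Metric_space M d"
    and "group_action G M \<phi>"
    and "isometric_action G M d \<phi>"
    and "proper_action G M d \<phi>"
    and "X \<subseteq> M" and "invariant_set G \<phi> X"
    and "Y \<subseteq> M" and "invariant_set G \<phi> Y"
  shows "hausdorff_dist (orbits G M \<phi>) (quotient_dist G M d \<phi>) (orbits G X \<phi>) (orbits G Y \<phi>)
         = hausdorff_dist M d X Y"
  \<comment> \<open>The equivalence is used twice, with X and Y exchanged. It rewrites the condition
    on \<open>\<epsilon>\<close> under the infimum, so the infinite case is covered too.\<close>
  unfolding hausdorff_dist_def
  by (simp only: orbits_subset_thickening_iff[OF assms(1-3) assms(5) assms(7,8)]
      orbits_subset_thickening_iff[OF assms(1-3) assms(7) assms(5,6)])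

end
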